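(* Let $m$ be a natural number, let $X_1,\dots,X_m\subseteq[\mathbb N]^\infty$ be $\mathfrak b$-generalized towers, and let $Y$ be a set of reals satisfying $\mathsf S_1(\Gamma_{\mathrm{Bor}},\Gamma_{\mathrm{Bor}})$. Then the product space $(X_1\cup\mathrm{Fin})\times\dots\times(X_m\cup\mathrm{Fin})\times Y$ satisfies $\mathsf S_1(\Gamma,\Gamma)$.
   Context: $\mathbb N=\{1,2,\dots\}$; $[\mathbb N]^\infty$ is the set of infinite subsets of $\mathbb N$ and $\mathrm{Fin}$ the set of finite subsets of $\mathbb N$. Both are viewed as subspaces of $P(\mathbb N)$, which is identified with the Cantor space $\{0,1\}^{\mathbb N}$ via characteristic functions. Each $a\in[\mathbb N]^\infty$ is identified with its increasing enumeration $a(1)<a(2)<\cdots$. For $n<m$, $[n,m)=\{i\in\mathbb N: n\le i<m\}$. A set of reals is a space homeomorphic to a subset of the real line. A set $X\subseteq[\mathbb N]^\infty$ is unbounded if for each $a\in[\mathbb N]^\infty$ there is $b\in X$ with $\{n: a(n)>b(n)\}$ infinite; $\mathfrak b$ is the minimal cardinality of an unbounded subset of $[\mathbb N]^\infty$. For an uncountable ordinal $\kappa$, a set $X\subseteq[\mathbb N]^\infty$ with $|X|\ge\kappa$ is a $\kappa$-generalized tower if for each $a\in[\mathbb N]^\infty$ there are $b\in[\mathbb N]^\infty$ and $S\subseteq X$ with $|S|<\kappa$ such that $x\cap\bigcup_{n\in b}[a(n),a(n+1))$ is finite for all $x\in X\setminus S$. A cover of a space is a family of proper subsets whose union is the whole space;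 it is open (Borel) if its members are open (Borel). A $\gamma$-cover is an infinite cover such that each point belongs to all but finitely many members. $\Gamma$ (respectively $\Gamma_{\mathrm{Bor}}$) is the class of open (respectively Borel) $\gamma$-covers; $\mathcal A(X)$ is the family of covers of $X$ from the class $\mathcal A$. $X$ satisfies $\mathsf S_1(\mathcal A,\mathcal B)$ if for each sequence $\mathcal U_1,\mathcal U_2,\dots\in\mathcal A(X)$ there are $U_1\in\mathcal U_1,U_2\in\mathcal U_2,\dots$ with $\{U_n:n\in\mathbb N\}\in\mathcal B(X)$.
   Formalization: "Unbounded" is read with {n : a(n) < b(n)} infinite instead of {n : a(n) > b(n)}; as printed, a = ℕ gives a(n) = n ≤ b(n) for all b, so no family would be unbounded and 𝔟 would be undefined. *)

theory Defs
  imports "HOL-Analysis.Analysis"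
begin

unbundle cardinal_syntax

section \<open>Sets of natural numbers\<close>

abbreviation NN :: "nat set" where
  "NN \<equiv> {1..}"

definition inf_subsets :: "nat set set" where
  "inf_subsets = {a. a \<subseteq> NN \<and> infinite a}"

definition fin_subsets :: "nat set set" where
  "fin_subsets = {a. a \<subseteq> NN \<and> finite a}"

text \<open>The increasing enumeration \<open>a(1) < a(2) < \<dots>\<close>, indexed from 1, whereas
  \<^const>\<open>enumerate\<close> starts at index 0; only meant for \<open>n \<ge> 1\<close>.\<close>

definition enum :: "nat set \<Rightarrow> nat \<Rightarrow> nat" where
  "enum a n = enumerate a (n - 1)"

definition cantor_space :: "nat set topology" where
  "cantor_space = pullback_topology (Pow NN) (\<lambda>a. \<lambda>n\<in>NN. n \<in> a)
     (product_topology (\<lambda>_. discrete_topology (UNIV :: bool set)) NN)"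

lemma topspace_cantor_space: "topspace cantor_space = Pow NN"
  by (auto simp: cantor_space_def topspace_pullback_topology)


section \<open>The bounding number and generalized towers\<close>

text \<open>The inequality is \<open>a(n) < b(n)\<close>. With the opposite inequality no family at all would be
  unbounded (take \<open>a = NN\<close>, so that \<open>a(n) = n \<le> b(n)\<close> for all \<open>b\<close>).\<close>

definition unbounded_family :: "nat set set \<Rightarrow> bool" where
  "unbounded_family X \<longleftrightarrow> X \<subseteq> inf_subsets \<and>
     (\<forall>a\<in>inf_subsets. \<exists>b\<in>X. infinite {n \<in> NN. enum a n < enum b n})"

text \<open>Cardinals are represented by well-orders, and compared up to order isomorphism; the minimum is
  attained by \<open>bounding_number_minimal\<close> below.\<close>

definition bounding_number :: "nat set rel" where
  "bounding_number =
     |SOME X. unbounded_family X \<and> (\<forall>Z. unbounded_family Z \<longrightarrow> |X| \<le>o |Z| )|"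

text \<open>The ordinal \<open>\<kappa>\<close> is given as a well-order; \<open>\<le>o\<close> and \<open><o\<close> compare well-orders as ordinals.\<close>

definition generalized_tower :: "'k rel \<Rightarrow> nat set set \<Rightarrow> bool" where
  "generalized_tower \<kappa> X \<longleftrightarrow>
     Well_order \<kappa> \<and> uncountable (Field \<kappa>) \<and> X \<subseteq> inf_subsets \<and> \<kappa> \<le>o |X| \<and>
     (\<forall>a\<in>inf_subsets. \<exists>b\<in>inf_subsets. \<exists>S\<subseteq>X. |S| <o \<kappa> \<and>
        (\<forall>x\<in>X - S. finite (x \<inter> (\<Union>n\<in>b. {enum a n..<enum a (n + 1)}))))"


section \<open>Covers and the selection principle\<close>

definition set_of_reals :: "'a topology \<Rightarrow> bool" where
  "set_of_reals T \<longleftrightarrow> (\<exists>S :: real set. T homeomorphic_space top_of_set S)"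

definition cover_of :: "'a topology \<Rightarrow> 'a set set \<Rightarrow> bool" where
  "cover_of T \<U> \<longleftrightarrow> (\<forall>U\<in>\<U>. U \<subset> topspace T) \<and> \<Union>\<U> = topspace T"

definition gamma_cover :: "'a topology \<Rightarrow> 'a set set \<Rightarrow> bool" where
  "gamma_cover T \<U> \<longleftrightarrow> cover_of T \<U> \<and> infinite \<U> \<and>
     (\<forall>x\<in>topspace T. finite {U \<in> \<U>. x \<notin> U})"

definition Borel_in :: "'a topology \<Rightarrow> 'a set \<Rightarrow> bool" where
  "Borel_in T B \<longleftrightarrow> B \<in> sigma_sets (topspace T) {U. openin T U}"

definition open_gamma_covers :: "'a topology \<Rightarrow> 'a set set set" where
  "open_gamma_covers T = {\<U>. gamma_cover T \<U> \<and> (\<forall>U\<in>\<U>. openin T U)}"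

definition Borel_gamma_covers :: "'a topology \<Rightarrow> 'a set set set" where
  "Borel_gamma_covers T = {\<U>. gamma_cover T \<U> \<and> (\<forall>U\<in>\<U>. Borel_in T U)}"

definition S1 :: "('a topology \<Rightarrow> 'a set set set) \<Rightarrow> ('a topology \<Rightarrow> 'a set set set) \<Rightarrow>
    'a topology \<Rightarrow> bool" where
  "S1 \<A> \<B> T \<longleftrightarrow> (\<forall>\<U>. (\<forall>n\<in>NN. \<U> n \<in> \<A> T) \<longrightarrow>
     (\<exists>U. (\<forall>n\<in>NN. U n \<in> \<U> n) \<and> {U n |n. n \<in> NN} \<in> \<B> T))"


section \<open>The bounding number is well defined and uncountable\<close>

lemma infinite_rangeI_strict:
  fixes g :: "nat \<Rightarrow> nat"
  assumes "strict_mono g"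
  shows "infinite (range g)"
  using assms by (simp add: finite_image_iff strict_mono_imp_inj_on)

lemma le_enumerate_range:
  fixes g :: "nat \<Rightarrow> nat"
  assumes g: "strict_mono g"
  shows "g n \<le> enumerate (range g) n"
proof (induction n)
  case 0
  have "enumerate (range g) 0 \<in> range g"
    using infinite_rangeI_strict[OF g] by (rule enumerate_in_set)
  then obtain k where "enumerate (range g) 0 = g k" by auto
  then show ?case using g by (simp add: strict_mono_less_eq)
next
  case (Suc n)
  have "enumerate (range g) (Suc n) \<in> range g"
    using infinite_rangeI_strict[OF g] by (rule enumerate_in_set)
  then obtain k where k: "enumerate (range g) (Suc n) = g k" by auto
  have "g n < g k"
    using Suc k enumerate_step[OF infinite_rangeI_strict[OF g], of n] by linarith
  then have "Suc n \<le> k" using g by (simp add: strict_mono_less Suc_le_eq)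
  then show ?case using g k by (simp add: strict_mono_less_eq)
qed

lemma dominating_element:
  fixes h :: "nat \<Rightarrow> nat \<Rightarrow> nat"
  obtains a where "a \<in> inf_subsets" "\<And>i n. i < n \<Longrightarrow> h i n < enum a n"
proof
  define g where "g m = (\<Sum>k\<le>m. \<Sum>i\<le>k. Suc (h i (Suc k)))" for m
  have g: "strict_mono g"
    by (simp add: strict_mono_Suc_iff g_def)
  have pos: "g m > 0" for m
    using strict_mono_less_eq[OF g, of 0 m] by (simp add: g_def)
  then show "range g \<in> inf_subsets"
    using infinite_rangeI_strict[OF g] by (auto simp: inf_subsets_def Suc_le_eq)
  fix i n :: nat assume "i < n"
  then obtain m where n: "n = Suc m" and im: "i \<le> m" by (cases n) auto
  have "Suc (h i n) \<le> (\<Sum>i\<le>m. Suc (h i (Suc m)))"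
    unfolding n using im by (intro member_le_sum) auto
  also have "\<dots> \<le> g m"
    unfolding g_def by (rule member_le_sum[where i = m]) auto
  also have "\<dots> \<le> enum (range g) n"
    using le_enumerate_range[OF g, of m] by (simp add: enum_def n)
  finally show "h i n < enum (range g) n" by simp
qed

lemma unbounded_family_inf_subsets: "unbounded_family inf_subsets"
  unfolding unbounded_family_def
proof (intro conjI ballI subset_refl)
  fix a
  obtain b where b: "b \<in> inf_subsets" "\<And>i n. i < n \<Longrightarrow> enum a n < enum b n"
    using dominating_element[of "\<lambda>i. enum a"] by blast
  have "{n \<in> NN. enum a n < enum b n} = NN" using b(2)[of 0] by auto
  then show "\<exists>b\<in>inf_subsets. infinite {n \<in> NN. enum a n < enum b n}"
    using b(1) infinite_Ici by metis
qed

lemma unbounded_family_uncountable: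
  assumes X: "unbounded_family X"
  shows "uncountable X"
proof
  assume "countable X"
  obtain a where a: "a \<in> inf_subsets"
    and dom: "\<And>i n. i < n \<Longrightarrow> enum (from_nat_into X i) n < enum a n"
    using dominating_element[of "\<lambda>i. enum (from_nat_into X i)"] by blast
  obtain b where b: "b \<in> X" and inf: "infinite {n \<in> NN. enum a n < enum b n}"
    using X a unfolding unbounded_family_def by blast
  obtain i where i: "b = from_nat_into X i"
    using from_nat_into_surj[OF \<open>countable X\<close> b] by metis
  have "{n \<in> NN. enum a n < enum b n} \<subseteq> {..i}"
    using dom[of i] i by (force simp: not_less)
  then show False using inf finite_subset by blast
qed

lemma bounding_number_minimal:
  obtains X where "unbounded_family X" "bounding_number = |X|"
    "\<And>Z. unbounded_family Z \<Longrightarrow> |X| \<le>o |Z|"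
proof -
  let ?P = "\<lambda>X. unbounded_family X \<and> (\<forall>Z. unbounded_family Z \<longrightarrow> |X| \<le>o |Z| )"
  have "\<exists>r\<in>card_of ` Collect unbounded_family. \<forall>r'\<in>card_of ` Collect unbounded_family. r \<le>o r'"
    using unbounded_family_inf_subsets by (intro exists_minim_Card_order) (auto simp: card_of_Card_order)
  then have "\<exists>X. ?P X" by auto
  then have "?P (SOME X. ?P X)" by (rule someI_ex)
  then show thesis using that bounding_number_def by blast
qed

lemma Card_order_bounding_number: "Card_order bounding_number"
  by (metis bounding_number_minimal card_of_Card_order)

lemma uncountable_bounding_number: "uncountable (Field bounding_number)"
  by (metis bounding_number_minimal Field_card_of unbounded_family_uncountable)

end

theory Submission
  imports Defs
begin

text \<open>
  Write \<open>A\<^sub>i\<close> for \<open>X\<^sub>i \<union> Fin\<close>. Fix a pattern \<open>p\<close> that freezes some of the coordinates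
  to given values. The other coordinates may be taken from the finitely many subsets of \<open>[1, M)\<close>,
  so for each \<open>y\<close> and almost all \<open>k\<close> there is \<open>M'\<close> such that \<open>U\<^sub>n\<^sub>,\<^sub>k\<close> contains a neighbourhood of
  \<open>{x. x matches p and its other coordinates miss [M, M')} \<times> {y}\<close>. By
  \<open>S\<^sub>1(\<Gamma>\<^sub>B\<^sub>o\<^sub>r, \<Gamma>\<^sub>B\<^sub>o\<^sub>r)\<close> the thresholds for \<open>k\<close> and for \<open>M'\<close> are, up to finitely many exceptions,
  independent of \<open>y\<close>, and even of \<open>p\<close> if fewer than \<open>\<bb>\<close> patterns are considered. If \<open>a\<close> grows faster
  than these thresholds, then the tower property, applied to \<open>a\<close>, yields a selection that is
  correct at all points whose coordinates are frozen ones or lie outside an exceptional set of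
  fewer than \<open>\<bb>\<close> elements.

  The exceptional elements are then frozen and the step is repeated, where the new selection is a
  re-indexing of the old one, so that it stays correct where the old one was. This gives an
  increasing chain \<open>S\<^sub>0 \<subseteq> \<dots> \<subseteq> S\<^sub>m\<^sub>+\<^sub>1\<close> of small sets. As a point has only \<open>m\<close> coordinates, there is
  \<open>t \<le> m\<close> such that none of them is in \<open>S\<^sub>t\<^sub>+\<^sub>1 - S\<^sub>t\<close>, and the step from \<open>S\<^sub>t\<close> to \<open>S\<^sub>t\<^sub>+\<^sub>1\<close> takes care of
  this point.
\<close>

subsection \<open>Gamma-covers and sequences\<close>

text \<open>The indexing may repeat a member, but only finitely often: a proper subset misses some
  point, and that point is missed at only finitely many indices. Hence the image is infinite as
  well.\<close>

lemma gamma_cover_imageI: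
  assumes "infinite I" and proper: "\<And>i. i \<in> I \<Longrightarrow> U i \<subset> topspace T"
    and ev: "\<And>x. x \<in> topspace T \<Longrightarrow> finite {i \<in> I. x \<notin> U i}"
  shows "gamma_cover T (U ` I)"
  unfolding gamma_cover_def cover_of_def
proof (intro conjI ballI)
  show "U' \<subset> topspace T" if "U' \<in> U ` I" for U'
    using that proper by auto
  show "\<Union> (U ` I) = topspace T"
  proof
    show "\<Union> (U ` I) \<subseteq> topspace T" using proper by auto
    show "topspace T \<subseteq> \<Union> (U ` I)"
    proof
      fix x assume "x \<in> topspace T"
      then have "{i \<in> I. x \<notin> U i} \<noteq> I" using ev \<open>infinite I\<close> by metis
      then show "x \<in> \<Union> (U ` I)" by auto
    qed
  qed
  show "infinite (U ` I)"
  proof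
    assume "finite (U ` I)"
    then obtain i where i: "i \<in> I" and inf: "infinite {j \<in> I. U j = U i}"
      using pigeonhole_infinite[OF \<open>infinite I\<close>] by auto
    obtain x where x: "x \<in> topspace T" "x \<notin> U i" using proper[OF i] by auto
    have "{j \<in> I. U j = U i} \<subseteq> {j \<in> I. x \<notin> U j}" using x by auto
    then show False using inf ev[OF x(1)] finite_subset by blast
  qed
  show "finite {V \<in> U ` I. x \<notin> V}" if "x \<in> topspace T" for x
    by (rule finite_subset[OF _ finite_imageI[OF ev[OF that], of U]]) auto
qed

text \<open>An infinite subfamily of a gamma-cover still contains each point in almost all members,
  so each cover can be replaced by an injective sequence of its members. As these are proper,
  eventual membership along the selection already makes it a gamma-cover.\<close>

lemma S1_open_gamma_coversI:
  fixes T :: "'a topology"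
  assumes "\<And>U :: nat \<Rightarrow> nat \<Rightarrow> 'a set. \<lbrakk>\<And>n k. openin T (U n k);
      \<And>n x. x \<in> topspace T \<Longrightarrow> \<forall>\<^sub>F k in cofinite. x \<in> U n k\<rbrakk>
    \<Longrightarrow> \<exists>f. \<forall>x\<in>topspace T. \<forall>\<^sub>F n in cofinite. x \<in> U n (f n)"
  shows "S1 open_gamma_covers open_gamma_covers T"
  unfolding S1_def
proof (intro allI impI)
  fix \<U> assume \<U>: "\<forall>n\<in>NN. \<U> n \<in> open_gamma_covers T"
  \<comment> \<open>\<open>Suc n\<close>, because \<open>S1\<close> numbers the covers from 1 and
    the hypothesis from 0. By injectivity, the finitely many members that miss a point occupy only
    finitely many \<open>k\<close>.\<close>
  have "\<exists>u :: nat \<Rightarrow> 'a set. inj u \<and> range u \<subseteq> \<U> (Suc n)" for n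
    using \<U> by (intro infinite_countable_subset) (auto simp: open_gamma_covers_def gamma_cover_def)
  then obtain u :: "nat \<Rightarrow> nat \<Rightarrow> 'a set"
    where inj: "\<And>n. inj (u n)" and mem: "\<And>n k. u n k \<in> \<U> (Suc n)"
    by (metis UNIV_I image_subset_iff)
  have cov: "\<U> (Suc n) \<in> open_gamma_covers T" for n using \<U> by auto
  have "\<exists>f. \<forall>x\<in>topspace T. \<forall>\<^sub>F n in cofinite. x \<in> u n (f n)"
  proof (rule assms)
    show "openin T (u n k)" for n k
      using cov mem by (auto simp: open_gamma_covers_def)
    fix n x assume "x \<in> topspace T"
    then have "finite {U \<in> \<U> (Suc n). x \<notin> U}"
      using cov[of n] by (auto simp: open_gamma_covers_def gamma_cover_def)
    then have "finite (u n -` {U \<in> \<U> (Suc n). x \<notin> U})"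
      using inj by (rule finite_vimageI)
    then show "\<forall>\<^sub>F k in cofinite. x \<in> u n k"
      using mem by (simp add: eventually_cofinite vimage_def)
  qed
  then obtain f where f: "\<And>x. x \<in> topspace T \<Longrightarrow> finite {n. x \<notin> u n (f n)}"
    by (auto simp: eventually_cofinite)
  define U where "U n = u (n - 1) (f (n - 1))" for n
  have U: "U n \<in> \<U> n" if "n \<in> NN" for n
    using mem[of "n - 1" "f (n - 1)"] that by (simp add: U_def)
  have "gamma_cover T (U ` NN)"
  proof (rule gamma_cover_imageI)
    show "infinite NN" by (rule infinite_Ici)
    show "U n \<subset> topspace T" if "n \<in> NN" for n
      using \<U> U that by (force simp: open_gamma_covers_def gamma_cover_def cover_of_def)
    show "finite {n \<in> NN. x \<notin> U n}" if "x \<in> topspace T" for x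
    proof (rule finite_subset)
      show "{n \<in> NN. x \<notin> U n} \<subseteq> Suc ` {n. x \<notin> u n (f n)}"
      proof
        fix n assume "n \<in> {n \<in> NN. x \<notin> U n}"
        then show "n \<in> Suc ` {n. x \<notin> u n (f n)}" by (cases n) (auto simp: U_def)
      qed
      show "finite (Suc ` {n. x \<notin> u n (f n)})" using f[OF that] by simp
    qed
  qed
  moreover have "openin T (U n)" if "n \<in> NN" for n
    using \<U> U that by (auto simp: open_gamma_covers_def)
  moreover have "{U n |n. n \<in> NN} = U ` NN" by auto
  ultimately have "{U n |n. n \<in> NN} \<in> open_gamma_covers T"
    by (auto simp: open_gamma_covers_def)
  then show "\<exists>U. (\<forall>n\<in>NN. U n \<in> \<U> n) \<and> {U n |n. n \<in> NN} \<in> open_gamma_covers T"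
    using U by blast
qed

section \<open>Borel sets and selections from sequences of Borel sets\<close>

lemma sigma_algebra_Borel_in: "sigma_algebra (topspace T) (Collect (Borel_in T))"
proof -
  have "{U. openin T U} \<subseteq> Pow (topspace T)" using openin_subset by auto
  then show ?thesis
    unfolding Borel_in_def Collect_mem_eq by (rule sigma_algebra_sigma_sets)
qed

lemma Borel_in_openin: "openin T U \<Longrightarrow> Borel_in T U"
  by (simp add: Borel_in_def sigma_sets.Basic)

lemma Borel_in_subset: "Borel_in T B \<Longrightarrow> B \<subseteq> topspace T"
  using sigma_sets_into_sp[of "{U. openin T U}" "topspace T"] openin_subset
  by (fastforce simp: Borel_in_def)

lemma Borel_in_Diff: "Borel_in T A \<Longrightarrow> Borel_in T B \<Longrightarrow> Borel_in T (A - B)"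
proof -
  interpret sigma_algebra "topspace T" "Collect (Borel_in T)"
    by (rule sigma_algebra_Borel_in)
  show "Borel_in T A \<Longrightarrow> Borel_in T B \<Longrightarrow> Borel_in T (A - B)"
    using Diff[of A B] by simp
qed

lemma Borel_in_Un: "Borel_in T A \<Longrightarrow> Borel_in T B \<Longrightarrow> Borel_in T (A \<union> B)"
  unfolding Borel_in_def by (rule sigma_sets_Un)

lemma Borel_in_Union:
  fixes A :: "nat \<Rightarrow> _"
  assumes "\<And>i. Borel_in T (A i)" shows "Borel_in T (\<Union>i. A i)"
  using assms by (simp add: Borel_in_def sigma_sets.Union)

lemma Borel_in_Inter:
  fixes A :: "nat \<Rightarrow> _"
  assumes "\<And>i. i \<in> J \<Longrightarrow> Borel_in T (A i)" "J \<noteq> {}" shows "Borel_in T (\<Inter>i\<in>J. A i)"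
  using sigma_algebra.countable_INT[OF sigma_algebra_Borel_in, of A J T] assms by auto

text \<open>Turns the principle, which speaks of families of proper subsets, into a choice function
  for arbitrary sequences of Borel sets. Full sets and repeated choices are the two
  obstacles.\<close>

lemma Borel_selection_nat:
  fixes B :: "nat \<Rightarrow> nat \<Rightarrow> 'a set"
  assumes S1: "S1 Borel_gamma_covers Borel_gamma_covers Y"
    and Borel: "\<And>n k. Borel_in Y (B n k)"
    and ev: "\<And>n y. y \<in> topspace Y \<Longrightarrow> \<forall>\<^sub>F k in cofinite. y \<in> B n k"
  obtains f where "\<And>y. y \<in> topspace Y \<Longrightarrow> \<forall>\<^sub>F n in cofinite. y \<in> B n (f n)"
proof -
  \<comment> \<open>Decreasing in \<open>n\<close>, so that a choice made at a later stage also
    serves every earlier one.\<close>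
  define C where "C n k = (\<Inter>i\<in>{..n}. B i k)" for n k
  have C_sub: "C n k \<subseteq> topspace Y" for n k
    using Borel_in_subset[OF Borel] by (auto simp: C_def)
  have C_anti: "C n k \<subseteq> C i k" if "i \<le> n" for i n k
    using that by (force simp: C_def)
  have C_B: "C n k \<subseteq> B i k" if "i \<le> n" for i n k
    using that by (auto simp: C_def)
  have C_Borel: "Borel_in Y (C n k)" for n k
    unfolding C_def by (rule Borel_in_Inter) (auto simp: Borel)
  have C_ev: "finite {k. y \<notin> C n k}" if "y \<in> topspace Y" for y n
  proof -
    have "\<forall>\<^sub>F k in cofinite. \<forall>i\<in>{..n}. y \<in> B i k"
      using ev[OF that] by (intro eventually_ball_finite) auto
    then show ?thesis by (simp add: C_def eventually_cofinite)
  qed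
  \<comment> \<open>Either the full set can be chosen at every stage, or from some \<open>n0\<close>
    on all the sets are proper, by monotonicity in \<open>n\<close>.\<close>
  show thesis
  proof (cases "\<forall>n. \<exists>k. C n k = topspace Y")
    case True
    then obtain f where "\<And>n. C n (f n) = topspace Y" by metis
    then have "y \<in> B n (f n)" if "y \<in> topspace Y" for y n
      using C_B[of n n "f n"] that by auto
    then show thesis using that[of f] by simp
  next
    case False
    then obtain n0 where n0: "\<And>k. C n0 k \<noteq> topspace Y" by auto
    have proper: "C (n0 + n) k \<subset> topspace Y" for n k
      using n0[of k] C_anti[of n0 "n0 + n" k] C_sub[of n0 k] by auto
    have "range (C (n0 + n)) \<in> Borel_gamma_covers Y" for n
      unfolding Borel_gamma_covers_def
      using proper C_Borel C_ev gamma_cover_imageI[of UNIV "C (n0 + n)" Y] by auto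
    then have "\<exists>U. (\<forall>n\<in>NN. U n \<in> range (C (n0 + n))) \<and> {U n |n. n \<in> NN} \<in> Borel_gamma_covers Y"
      using S1[unfolded S1_def, THEN spec, of "\<lambda>n. range (C (n0 + n))"] by simp
    then obtain U where U: "\<forall>n\<in>NN. U n \<in> range (C (n0 + n))"
      and sel: "{U n |n. n \<in> NN} \<in> Borel_gamma_covers Y"
      by (elim exE conjE)
    have img: "{U n |n. n \<in> NN} = U ` NN" by auto
    \<comment> \<open>The selection is a gamma-cover only as a set. \<open>J\<close> indexes each
      member once, so a point is missed at only finitely many indices in \<open>J\<close>; the
      choice at \<open>j n \<ge> n\<close> is then used for stage \<open>n\<close>.\<close>
    obtain J where J: "J \<subseteq> NN" "inj_on U J" "U ` J = U ` NN"
      using subset_image_inj[of "U ` NN" U NN] by (metis subset_refl)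
    have gamma: "gamma_cover Y (U ` J)"
      using sel unfolding img J(3) by (simp add: Borel_gamma_covers_def)
    then have "infinite (U ` J)" by (simp add: gamma_cover_def)
    then have "infinite J" by auto
    then have "\<exists>j\<in>J. n \<le> j" for n
      unfolding infinite_nat_iff_unbounded_le by auto
    then obtain j where j: "\<And>n. j n \<in> J" "\<And>n. n \<le> j n" by metis
    have "\<exists>k. U (j n) = C (n0 + j n) k" for n
      using U j(1)[of n] J(1) by blast
    then obtain f where f: "\<And>n. U (j n) = C (n0 + j n) (f n)" by metis
    have "finite {n. y \<notin> B n (f n)}" if "y \<in> topspace Y" for y
    proof -
      have "finite {V \<in> U ` J. y \<notin> V}"
        using gamma that by (simp add: gamma_cover_def)
      then have "finite (U -` {V \<in> U ` J. y \<notin> V} \<inter> J)"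
        using J(2) by (rule finite_vimage_IntI)
      moreover have "U -` {V \<in> U ` J. y \<notin> V} \<inter> J = {i \<in> J. y \<notin> U i}" by auto
      ultimately obtain N where N: "\<And>i. i \<in> J \<Longrightarrow> y \<notin> U i \<Longrightarrow> i \<le> N"
        unfolding finite_nat_set_iff_bounded_le by auto
      have "n \<le> N" if "y \<notin> B n (f n)" for n
      proof -
        have "C (n0 + j n) (f n) \<subseteq> B n (f n)" using j(2)[of n] by (intro C_B) simp
        then have "y \<notin> U (j n)" using that f[of n] by auto
        then show ?thesis using N j le_trans by metis
      qed
      then show ?thesis unfolding finite_nat_set_iff_bounded_le by blast
    qed
    then show thesis using that[of f] by (simp add: eventually_cofinite)
  qed
qed

text \<open>Pairs and triples of numbers will serve as indices.\<close>

lemma Borel_selection: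
  fixes B :: "'c :: countable \<Rightarrow> nat \<Rightarrow> 'a set"
  assumes S1: "S1 Borel_gamma_covers Borel_gamma_covers Y"
    and Borel: "\<And>c k. Borel_in Y (B c k)"
    and ev: "\<And>c y. y \<in> topspace Y \<Longrightarrow> \<forall>\<^sub>F k in cofinite. y \<in> B c k"
  obtains f where "\<And>y. y \<in> topspace Y \<Longrightarrow> \<forall>\<^sub>F c in cofinite. y \<in> B c (f c)"
proof -
  obtain f where f: "\<And>y. y \<in> topspace Y \<Longrightarrow> \<forall>\<^sub>F n in cofinite. y \<in> B (from_nat n) (f n)"
    using Borel_selection_nat[OF S1, of "\<lambda>n. B (from_nat n)"] Borel ev by blast
  have "\<forall>\<^sub>F c in cofinite. y \<in> B c (f (to_nat c))" if "y \<in> topspace Y" for y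
  proof -
    have "finite (to_nat -` {n. y \<notin> B (from_nat n) (f n)} :: 'c set)"
      using f[OF that] by (intro finite_vimageI) (auto simp: eventually_cofinite)
    then show ?thesis by (simp add: eventually_cofinite vimage_def)
  qed
  then show thesis by (rule that[of "\<lambda>c. f (to_nat c)"])
qed

subsection \<open>Families of size less than the bounding number\<close>

abbreviation small :: "'a set \<Rightarrow> bool" where
  "small A \<equiv> |A| <o bounding_number"

lemma infinite_bounding_number: "\<not> finite (Field bounding_number)"
  using uncountable_bounding_number countable_finite by blast

lemma small_finite: "finite A \<Longrightarrow> small A"
  using infinite_bounding_number Card_order_bounding_number
  by (metis finite_ordLess_infinite card_of_Well_order card_order_on_well_order_on Field_card_of)

lemma small_Un: "small A \<Longrightarrow> small B \<Longrightarrow> small (A \<union> B)"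
  using card_of_Un_ordLess_infinite_Field infinite_bounding_number Card_order_bounding_number by blast

lemma small_image: "small A \<Longrightarrow> small (f ` A)"
  using card_of_image ordLeq_ordLess_trans by blast

lemma small_Times:
  assumes "small A" "small B"
  shows "small (A \<times> B)"
proof (cases "A = {} \<or> B = {} \<or> finite A \<and> finite B")
  case True
  then show ?thesis by (auto intro: small_finite)
next
  case False
  then consider "infinite A" "|B| \<le>o |A|" | "infinite B" "|A| \<le>o |B|"
    by (metis card_of_Well_order card_of_ordLeq_infinite ordLeq_total)
  then show ?thesis
  proof cases
    case 1
    then show ?thesis
      using False assms(1) card_of_Times_infinite[of A B] ordIso_ordLess_trans by blast
  next
    case 2
    then show ?thesis
      using False assms(2) card_of_Times_infinite[of B A] ordIso_ordLess_trans by blast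
  qed
qed

lemma small_PiE:
  assumes "finite I" "\<And>i. i \<in> I \<Longrightarrow> small (A i)"
  shows "small (PiE I A)"
  using assms
proof (induction I)
  case empty
  then show ?case by (simp add: small_finite)
next
  case (insert i I)
  then show ?case
    by (simp add: PiE_insert_eq small_image small_Times)
qed

lemma enumerate_range:
  fixes g :: "nat \<Rightarrow> nat"
  assumes g: "strict_mono g"
  shows "enumerate (range g) = g"
proof -
  have "enumerate (range g) n \<le> g n" for n
  proof (induction n)
    case 0
    then show ?case by (simp add: enumerate_0 Least_le)
  next
    case (Suc n)
    then have "enumerate (range g) n < g (Suc n)"
      using g by (meson le_less_trans lessI strict_mono_less)
    then show ?case
      using infinite_rangeI_strict[OF g] by (simp add: enumerate_Suc'' Least_le)
  qed
  then show ?thesis using le_enumerate_range[OF g] by (auto intro: antisym)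
qed

text \<open>Partial sums turn each \<open>g p\<close> into a strictly increasing positive function
  above it, that is, into an element of \<open>inf_subsets\<close>. A small family of these cannot
  be unbounded.\<close>

lemma small_dominated_nat:
  fixes g :: "'p \<Rightarrow> nat \<Rightarrow> nat"
  assumes "small P"
  obtains f where "\<And>p. p \<in> P \<Longrightarrow> \<forall>\<^sub>F n in cofinite. g p n \<le> f n"
proof -
  define h where "h p n = (\<Sum>i\<le>n. Suc (g p i))" for p n
  have h: "strict_mono (h p)" for p by (simp add: strict_mono_Suc_iff h_def)
  have h_pos: "0 < h p n" for p n by (simp add: h_def sum_pos)
  have gh: "g p n < h p n" for p n
    using member_le_sum[of n "{..n}" "\<lambda>i. Suc (g p i)"] by (simp add: h_def)
  let ?Z = "(\<lambda>p. range (h p)) ` P"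
  have "\<not> unbounded_family ?Z"
  proof
    assume "unbounded_family ?Z"
    moreover obtain X where "bounding_number = |X|"
      "\<And>Z. unbounded_family Z \<Longrightarrow> |X| \<le>o |Z|"
      using bounding_number_minimal by metis
    ultimately have "bounding_number \<le>o |?Z|" by metis
    then show False using small_image[OF assms] not_ordLess_ordLeq by blast
  qed
  moreover have "?Z \<subseteq> inf_subsets"
    using infinite_rangeI_strict[OF h] h_pos by (auto simp: inf_subsets_def Suc_le_eq)
  ultimately obtain a where a: "\<And>b. b \<in> ?Z \<Longrightarrow> finite {n \<in> NN. enum a n < enum b n}"
    unfolding unbounded_family_def by blast
  have "\<forall>\<^sub>F n in cofinite. g p n \<le> enumerate a n" if "p \<in> P" for p
  proof -
    have "finite {n \<in> NN. enum a n < enum (range (h p)) n}" using a that by blast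
    then have "finite (Suc -` {n \<in> NN. enum a n < enum (range (h p)) n})"
      by (intro finite_vimageI) auto
    moreover have "{n. \<not> g p n \<le> enumerate a n} \<subseteq>
        Suc -` {n \<in> NN. enum a n < enum (range (h p)) n}"
      using less_le_trans[OF gh le_enumerate_range[OF h]]
      by (force simp: enum_def not_le intro: less_trans)
    ultimately show ?thesis
      unfolding eventually_cofinite by (rule finite_subset[rotated])
  qed
  then show thesis by (rule that[of "enumerate a"])
qed

lemma small_dominated:
  fixes g :: "'p \<Rightarrow> 'c :: countable \<Rightarrow> nat"
  assumes "small P"
  obtains f where "\<And>p. p \<in> P \<Longrightarrow> \<forall>\<^sub>F c in cofinite. g p c \<le> f c"
proof -
  obtain f where f: "\<And>p. p \<in> P \<Longrightarrow> \<forall>\<^sub>F n in cofinite. g p (from_nat n) \<le> f n"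
    using small_dominated_nat[OF assms, of "\<lambda>p n. g p (from_nat n)"] by blast
  have "\<forall>\<^sub>F c in cofinite. g p c \<le> f (to_nat c)" if "p \<in> P" for p
  proof -
    have "finite (to_nat -` {n. \<not> g p (from_nat n) \<le> f n} :: 'c set)"
      using f[OF that] by (intro finite_vimageI) (auto simp: eventually_cofinite)
    then show ?thesis by (simp add: eventually_cofinite vimage_def)
  qed
  then show thesis by (rule that[of "\<lambda>c. f (to_nat c)"])
qed

text \<open>For each \<open>p\<close> separately, \<open>Borel_selection\<close> yields thresholds
  \<open>g p\<close>. One \<open>f\<close> dominates all of them because \<open>P\<close> is small,
  and monotonicity allows passing from \<open>g p c\<close> to a larger \<open>f c\<close>.\<close>

lemma Borel_domination:
  fixes B :: "'p \<Rightarrow> 'c :: countable \<Rightarrow> nat \<Rightarrow> 'a set"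
  assumes S1: "S1 Borel_gamma_covers Borel_gamma_covers Y"
    and P: "small P"
    and Borel: "\<And>p c k. p \<in> P \<Longrightarrow> Borel_in Y (B p c k)"
    and mono: "\<And>p c. p \<in> P \<Longrightarrow> mono (B p c)"
    and cover: "\<And>p c y. p \<in> P \<Longrightarrow> y \<in> topspace Y \<Longrightarrow> \<exists>k. y \<in> B p c k"
  obtains f where
    "\<And>p y. p \<in> P \<Longrightarrow> y \<in> topspace Y \<Longrightarrow> \<forall>\<^sub>F c in cofinite. y \<in> B p c (f c)"
proof -
  have "\<exists>g. \<forall>y\<in>topspace Y. \<forall>\<^sub>F c in cofinite. y \<in> B p c (g c)" if p: "p \<in> P" for p
  proof -
    have ev: "\<forall>\<^sub>F k in cofinite. y \<in> B p c k" if y: "y \<in> topspace Y" for c y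
    proof -
      obtain k where "y \<in> B p c k" using cover[OF p y] by blast
      then have "\<forall>l\<ge>k. y \<in> B p c l" using monoD[OF mono[OF p]] by blast
      then show ?thesis unfolding cofinite_eq_sequentially eventually_sequentially by blast
    qed
    obtain g where "\<And>y. y \<in> topspace Y \<Longrightarrow> \<forall>\<^sub>F c in cofinite. y \<in> B p c (g c)"
      by (rule Borel_selection[OF S1, of "B p"]) (use Borel[OF p] ev in auto)
    then show ?thesis by blast
  qed
  then obtain g where g: "\<And>p y. p \<in> P \<Longrightarrow> y \<in> topspace Y \<Longrightarrow> \<forall>\<^sub>F c in cofinite. y \<in> B p c (g p c)"
    by metis
  obtain f where f: "\<And>p. p \<in> P \<Longrightarrow> \<forall>\<^sub>F c in cofinite. g p c \<le> f c"
    using small_dominated[OF P] by blast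
  have "\<forall>\<^sub>F c in cofinite. y \<in> B p c (f c)" if "p \<in> P" "y \<in> topspace Y" for p y
    using g[OF that] f[OF that(1)]
    by eventually_elim (use monoD[OF mono[OF that(1)]] in blast)
  then show thesis by (rule that[of f])
qed

subsection \<open>Towers and interval partitions\<close>

text \<open>The tower property for endpoints numbered from 0. Positivity of \<open>a 0\<close>
  places \<open>range a\<close> inside \<open>NN\<close>.\<close>

lemma generalized_tower_strict_mono:
  fixes a :: "nat \<Rightarrow> nat"
  assumes X: "generalized_tower \<kappa> X" and a: "strict_mono a" "0 < a 0"
  obtains b S where "infinite b" "|S| <o \<kappa>"
    "\<And>x. x \<in> X \<Longrightarrow> x \<notin> S \<Longrightarrow> finite (x \<inter> (\<Union>j\<in>b. {a j..<a (Suc j)}))"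
proof -
  have "0 < a n" for n
    using a strict_mono_less_eq[OF a(1), of 0 n] by linarith
  then have "range a \<in> inf_subsets"
    using infinite_rangeI_strict[OF a(1)] by (auto simp: inf_subsets_def Suc_le_eq)
  then have "\<exists>b\<in>inf_subsets. \<exists>S\<subseteq>X. |S| <o \<kappa> \<and>
      (\<forall>x\<in>X - S. finite (x \<inter> (\<Union>n\<in>b. {enum (range a) n..<enum (range a) (n + 1)})))"
    using X unfolding generalized_tower_def by simp
  then obtain b S where b: "b \<in> inf_subsets" and S: "|S| <o \<kappa>"
    and fin: "\<forall>x\<in>X - S. finite (x \<inter> (\<Union>n\<in>b. {enum (range a) n..<enum (range a) (n + 1)}))"
    by (elim bexE exE conjE)
  \<comment> \<open>\<open>enum\<close> counts from 1, so interval \<open>n\<close> of the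
    definition is interval \<open>n - 1\<close> of \<open>a\<close>. As 0 is not in
    \<open>b\<close>, shifting \<open>b\<close> down by one loses nothing.\<close>
  have b_Suc: "b = Suc ` (Suc -` b)"
  proof
    show "b \<subseteq> Suc ` (Suc -` b)"
    proof
      fix n assume "n \<in> b"
      then show "n \<in> Suc ` (Suc -` b)" using b by (cases n) (auto simp: inf_subsets_def)
    qed
  qed auto
  have "(\<Union>n\<in>b. {enum (range a) n..<enum (range a) (n + 1)}) = (\<Union>j\<in>Suc -` b. {a j..<a (Suc j)})"
    by (subst b_Suc) (simp only: enum_def enumerate_range[OF a(1)] UN_simps image_image
        add_diff_cancel_right' diff_Suc_1 Suc_eq_plus1[symmetric])
  moreover have "infinite (Suc -` b)"
  proof
    assume "finite (Suc -` b)"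
    then have "finite b" by (subst b_Suc) (rule finite_imageI)
    then show False using b by (simp add: inf_subsets_def)
  qed
  ultimately show thesis
    using fin by (intro that[OF _ S, of "Suc -` b"]) auto
qed

text \<open>One \<open>b\<close> serves all towers: the set \<open>b\<close> found for the earlier
  ones is enumerated by \<open>e\<close>, the new tower is applied to the coarser partition with
  endpoints \<open>a (e j)\<close>, and \<open>b\<close> is thinned to the \<open>e j\<close> with
  \<open>j\<close> in the resulting \<open>c\<close>.\<close>

lemma generalized_towers_strict_mono:
  fixes a :: "nat \<Rightarrow> nat" and X :: "'i \<Rightarrow> nat set set"
  assumes "finite I" "\<And>i. i \<in> I \<Longrightarrow> generalized_tower bounding_number (X i)"
    and a: "strict_mono a" "0 < a 0"
  shows "\<exists>b S. infinite b \<and> small S \<and>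
    (\<forall>i\<in>I. \<forall>x\<in>X i - S. finite (x \<inter> (\<Union>j\<in>b. {a j..<a (Suc j)})))"
  using assms(1,2)
proof (induction I)
  case empty
  have "infinite (UNIV :: nat set)" "small ({} :: nat set set)"
    by (simp_all add: small_finite)
  then show ?case by blast
next
  case (insert i I)
  then obtain b S where b: "infinite b" and S: "small S"
    and fin: "\<forall>i\<in>I. \<forall>x\<in>X i - S. finite (x \<inter> (\<Union>j\<in>b. {a j..<a (Suc j)}))"
    by (metis insertI2)
  define e where "e = enumerate b"
  have e: "strict_mono e" "range e = b"
    using b by (simp_all add: e_def strict_mono_enumerate range_enumerate)
  have "strict_mono (a \<circ> e)" using a(1) e(1) by (rule strict_mono_o)
  moreover have "0 < (a \<circ> e) 0"
    using a strict_mono_less_eq[OF a(1), of 0 "e 0"] by auto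
  ultimately obtain c S' where c: "infinite c" and S': "small S'"
    and fin': "\<And>x. x \<in> X i \<Longrightarrow> x \<notin> S' \<Longrightarrow>
        finite (x \<inter> (\<Union>j\<in>c. {(a \<circ> e) j..<(a \<circ> e) (Suc j)}))"
    using generalized_tower_strict_mono[of bounding_number "X i" "a \<circ> e"] insert.prems by blast
  have inf: "infinite (e ` c)"
    using c e(1) by (simp add: finite_image_iff strict_mono_imp_inj_on)
  \<comment> \<open>The coarse interval from \<open>a (e j)\<close> to \<open>a (e (Suc j))\<close>
    contains the original interval number \<open>e j\<close>.\<close>
  have sub: "(\<Union>j\<in>e ` c. {a j..<a (Suc j)}) \<subseteq> (\<Union>j\<in>c. {(a \<circ> e) j..<(a \<circ> e) (Suc j)})"
  proof -
    have "a (Suc (e j)) \<le> a (e (Suc j))" for j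
      using e(1) by (simp add: strict_mono_less_eq[OF a(1)] Suc_le_eq strict_mono_Suc_iff)
    then show ?thesis by (fastforce intro: less_le_trans)
  qed
  have sub': "(\<Union>j\<in>e ` c. {a j..<a (Suc j)}) \<subseteq> (\<Union>j\<in>b. {a j..<a (Suc j)})"
    using e(2) by blast
  have "finite (x \<inter> (\<Union>j\<in>e ` c. {a j..<a (Suc j)}))"
    if "i' \<in> insert i I" "x \<in> X i' - (S \<union> S')" for i' x
  proof (cases "i' = i")
    case True
    then show ?thesis using fin'[of x] that sub by (meson DiffD1 DiffD2 Int_mono UnI2 finite_subset subset_refl)
  next
    case False
    then show ?thesis using fin that sub' by (meson DiffD1 DiffD2 DiffI Int_mono UnI1 finite_subset insertE subset_refl)
  qed
  then show ?case using inf small_Un[OF S S'] by blast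
qed

subsection \<open>Open sets in the product\<close>

text \<open>A basic open set restricts only finitely many coordinates; \<open>M\<close> exceeds them
  all.\<close>

lemma openin_cantor_space_cylinder:
  assumes "openin cantor_space V" "x \<in> V"
  obtains M where "\<And>x'. x' \<subseteq> NN \<Longrightarrow> x' \<inter> {..<M} = x \<inter> {..<M} \<Longrightarrow> x' \<in> V"
proof -
  let ?\<chi> = "\<lambda>a. \<lambda>n\<in>NN. n \<in> a"
  obtain W where W: "openin (product_topology (\<lambda>_. discrete_topology (UNIV :: bool set)) NN) W"
    and V: "V = ?\<chi> -` W \<inter> Pow NN"
    using assms(1) by (auto simp: cantor_space_def openin_pullback_topology)
  have "?\<chi> x \<in> W" using assms(2) V by auto
  then obtain U where fin: "finite {n \<in> NN. U n \<noteq> (UNIV :: bool set)}"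
    and U: "?\<chi> x \<in> PiE NN U" "PiE NN U \<subseteq> W"
    using W unfolding openin_product_topology_alt by force
  obtain M where M: "\<And>n. n \<in> NN \<Longrightarrow> U n \<noteq> UNIV \<Longrightarrow> n < M"
    using fin unfolding finite_nat_set_iff_bounded by auto
  have "x' \<in> V" if x': "x' \<subseteq> NN" "x' \<inter> {..<M} = x \<inter> {..<M}" for x'
  proof -
    have "(n \<in> x') \<in> U n" if n: "n \<in> NN" for n
    proof (cases "U n = UNIV")
      case False
      then have "n \<in> x' \<longleftrightarrow> n \<in> x" using M[OF n] x'(2) by blast
      moreover have "(n \<in> x) \<in> U n" using PiE_mem[OF U(1) n] n by simp
      ultimately show ?thesis by simp
    qed simp
    then have "?\<chi> x' \<in> PiE NN U" by auto
    then have "?\<chi> x' \<in> W" using U(2) by (rule rev_subsetD)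
    then show ?thesis using V x'(1) by simp
  qed
  then show thesis by (rule that)
qed

lemma openin_prod_cylinder:
  fixes I :: "'i set" and A :: "'i \<Rightarrow> nat set set"
  defines "T \<equiv> product_topology (\<lambda>i. subtopology cantor_space (A i)) I"
  assumes I: "finite I" and A: "\<And>i. i \<in> I \<Longrightarrow> A i \<subseteq> Pow NN"
    and U: "openin (prod_topology T Y) U" "(x, y) \<in> U"
  obtains M O' where "openin Y O'" "y \<in> O'"
    "\<And>x'. x' \<in> PiE I A \<Longrightarrow> (\<And>i. i \<in> I \<Longrightarrow> x' i \<inter> {..<M} = x i \<inter> {..<M}) \<Longrightarrow> {x'} \<times> O' \<subseteq> U"
proof -
  obtain W O' where W: "openin T W" "x \<in> W" and O': "openin Y O'" "y \<in> O'" and WO: "W \<times> O' \<subseteq> U"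
    using U unfolding openin_prod_topology_alt by metis
  obtain V where V: "\<And>i. i \<in> I \<Longrightarrow> openin (subtopology cantor_space (A i)) (V i)"
    and xV: "x \<in> PiE I V" and VW: "PiE I V \<subseteq> W"
    using W unfolding T_def openin_product_topology_alt by metis
  have "\<exists>M. \<forall>x'. x' \<in> A i \<longrightarrow> x' \<inter> {..<M} = x i \<inter> {..<M} \<longrightarrow> x' \<in> V i" if i: "i \<in> I" for i
  proof -
    obtain G where G: "openin cantor_space G" "V i = G \<inter> A i"
      using V[OF i] unfolding openin_subtopology by blast
    have "x i \<in> G" using xV i G(2) by auto
    from openin_cantor_space_cylinder[OF G(1) this] show ?thesis
      using G(2) A[OF i] by (metis IntI PowD subsetD)
  qed
  then obtain M where M: "\<And>i x'. i \<in> I \<Longrightarrow> x' \<in> A i \<Longrightarrow>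
      x' \<inter> {..<M i} = x i \<inter> {..<M i} \<Longrightarrow> x' \<in> V i"
    by metis
  define N where "N = Max (insert 0 (M ` I))"
  have MN: "M i \<le> N" if "i \<in> I" for i
    using I that by (simp add: N_def)
  have "{x'} \<times> O' \<subseteq> U"
    if x': "x' \<in> PiE I A" and eq: "\<And>i. i \<in> I \<Longrightarrow> x' i \<inter> {..<N} = x i \<inter> {..<N}" for x'
  proof -
    have "x' i \<in> V i" if i: "i \<in> I" for i
    proof (rule M[OF i])
      show "x' i \<in> A i" using x' i by auto
      show "x' i \<inter> {..<M i} = x i \<inter> {..<M i}"
        using eq[OF i] MN[OF i] by (metis Int_assoc inf.absorb_iff2 lessThan_subset_iff)
    qed
    then have "x' \<in> PiE I V" using x' by (auto simp: PiE_iff)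
    then have "x' \<in> W" using VW by (rule rev_subsetD)
    then show ?thesis using WO by auto
  qed
  then show thesis using that O' by blast
qed

text \<open>\<open>p i = Some s\<close> freezes coordinate \<open>i\<close> to the value \<open>s\<close>.\<close>

definition gap_box :: "'i set \<Rightarrow> ('i \<Rightarrow> nat set set) \<Rightarrow> ('i \<Rightarrow> nat set option) \<Rightarrow> nat \<Rightarrow> nat \<Rightarrow>
    ('i \<Rightarrow> nat set) set" where
  "gap_box I A p M M' = {x \<in> PiE I A. \<forall>i\<in>I.
     case p i of None \<Rightarrow> x i \<inter> {M..<M'} = {} | Some s \<Rightarrow> x i = s}"

text \<open>The largest such set is open by construction, for arbitrary \<open>G\<close>: no compactness is involved.\<close>

definition tube :: "'b topology \<Rightarrow> 'c set \<Rightarrow> ('c \<times> 'b) set \<Rightarrow> 'b set" where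
  "tube Y G U = \<Union>{O'. openin Y O' \<and> G \<times> O' \<subseteq> U}"

lemma openin_tube: "openin Y (tube Y G U)"
  unfolding tube_def by (rule openin_Union) auto

lemma tube_mono: "G \<subseteq> G' \<Longrightarrow> tube Y G' U \<subseteq> tube Y G U"
  unfolding tube_def by blast

lemma tubeD: "y \<in> tube Y G U \<Longrightarrow> x \<in> G \<Longrightarrow> (x, y) \<in> U"
  unfolding tube_def by blast

lemma gap_boxD:
  assumes "x \<in> gap_box I A p M M'" "i \<in> I"
  shows "p i = None \<Longrightarrow> x i \<inter> {M..<M'} = {}" and "p i = Some s \<Longrightarrow> x i = s"
proof -
  have "case p i of None \<Rightarrow> x i \<inter> {M..<M'} = {} | Some s \<Rightarrow> x i = s"
    using assms by (simp add: gap_box_def)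
  then show "p i = None \<Longrightarrow> x i \<inter> {M..<M'} = {}" and "p i = Some s \<Longrightarrow> x i = s"
    by simp_all
qed

lemma gap_box_antimono: "M' \<le> M'' \<Longrightarrow> gap_box I A p M M'' \<subseteq> gap_box I A p M M'"
  unfolding gap_box_def by (fastforce split: option.split)

text \<open>Only finitely many points match \<open>p\<close> and have their free coordinates below
  \<open>M\<close>. For almost all \<open>k\<close>, all of them lie in \<open>U k\<close> over
  \<open>y\<close>, each with a cylinder neighbourhood. If \<open>M'\<close> bounds the cylinder
  lengths, every point of the gap box agrees with one of these points as far as its cylinder
  looks.\<close>

lemma eventually_tube_gap_box:
  fixes I :: "'i set" and A :: "'i \<Rightarrow> nat set set" and U :: "nat \<Rightarrow> (('i \<Rightarrow> nat set) \<times> 'b) set"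
  defines "T \<equiv> product_topology (\<lambda>i. subtopology cantor_space (A i)) I"
  assumes I: "finite I" and A: "\<And>i. i \<in> I \<Longrightarrow> A i \<subseteq> Pow NN" "\<And>i. i \<in> I \<Longrightarrow> fin_subsets \<subseteq> A i"
    and U: "\<And>k. openin (prod_topology T Y) (U k)"
    and ev: "\<And>x. x \<in> PiE I A \<Longrightarrow> \<forall>\<^sub>F k in cofinite. (x, y) \<in> U k"
    and y: "y \<in> topspace Y"
  shows "\<forall>\<^sub>F k in cofinite. \<exists>M'. y \<in> tube Y (gap_box I A p M M') (U k)"
proof -
  \<comment> \<open>Intersecting with \<open>A i\<close> keeps \<open>F\<close> inside the product
    even if a frozen value lies outside \<open>A i\<close>; \<open>F\<close> is then empty.\<close>
  define F where "F = PiE I (\<lambda>i. case p i of None \<Rightarrow> Pow (NN \<inter> {..<M}) | Some s \<Rightarrow> {s} \<inter> A i)"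
  have "finite F"
    unfolding F_def using I by (intro finite_PiE) (auto split: option.split)
  have F_sub: "F \<subseteq> PiE I A"
    unfolding F_def
  proof (rule PiE_mono)
    fix i assume i: "i \<in> I"
    have "Pow (NN \<inter> {..<M}) \<subseteq> fin_subsets"
      by (auto simp: fin_subsets_def intro: finite_subset[of _ "{..<M}"])
    then show "(case p i of None \<Rightarrow> Pow (NN \<inter> {..<M}) | Some s \<Rightarrow> {s} \<inter> A i) \<subseteq> A i"
      using A(2)[OF i] by (cases "p i") auto
  qed
  have "\<forall>\<^sub>F k in cofinite. \<forall>x\<in>F. (x, y) \<in> U k"
    using \<open>finite F\<close> ev F_sub by (intro eventually_ball_finite) auto
  then show ?thesis
  proof eventually_elim
    case (elim k)
    have "\<exists>N O'. openin Y O' \<and> y \<in> O' \<and> (\<forall>x'\<in>PiE I A.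
        (\<forall>i\<in>I. x' i \<inter> {..<N} = x i \<inter> {..<N}) \<longrightarrow> {x'} \<times> O' \<subseteq> U k)" if "x \<in> F" for x
    proof -
      have "(x, y) \<in> U k" using elim that by blast
      from openin_prod_cylinder[OF I A(1) U[unfolded T_def] this] show ?thesis by metis
    qed
    then obtain N O' where O': "\<And>x. x \<in> F \<Longrightarrow> openin Y (O' x)" "\<And>x. x \<in> F \<Longrightarrow> y \<in> O' x"
      and NO: "\<And>x x'. x \<in> F \<Longrightarrow> x' \<in> PiE I A \<Longrightarrow>
        (\<forall>i\<in>I. x' i \<inter> {..<N x} = x i \<inter> {..<N x}) \<Longrightarrow> {x'} \<times> O' x \<subseteq> U k"
      by metis
    define M' where "M' = Max (insert 0 (N ` F))"
    have NM: "N x \<le> M'" if "x \<in> F" for x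
      using \<open>finite F\<close> that by (simp add: M'_def)
    \<comment> \<open>Intersecting with \<open>topspace Y\<close> covers the case of empty
      \<open>F\<close>.\<close>
    define Q where "Q = topspace Y \<inter> \<Inter> (O' ` F)"
    have "openin Y Q" unfolding Q_def
      using \<open>finite F\<close> O'(1) by (cases "F = {}") (auto intro!: openin_Int openin_Inter)
    moreover have "y \<in> Q" using y O'(2) by (auto simp: Q_def)
    moreover have "gap_box I A p M M' \<times> Q \<subseteq> U k"
    proof clarify
      fix x' q assume x': "x' \<in> gap_box I A p M M'" and q: "q \<in> Q"
      \<comment> \<open>The free coordinates are truncated at \<open>M\<close>. As they miss
        everything from \<open>M\<close> up to \<open>M'\<close>, nothing below \<open>M'\<close>
        changes.\<close>
      define x where "x = (\<lambda>i\<in>I. case p i of None \<Rightarrow> x' i \<inter> {..<M} | Some s \<Rightarrow> s)"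
      have x'A: "x' i \<in> A i" if "i \<in> I" for i
        using x' that by (auto simp: gap_box_def)
      have "x \<in> F"
        unfolding F_def x_def
      proof (rule restrict_PiE_iff[THEN iffD2], rule ballI)
        fix i assume i: "i \<in> I"
        show "(case p i of None \<Rightarrow> x' i \<inter> {..<M} | Some s \<Rightarrow> s) \<in>
            (case p i of None \<Rightarrow> Pow (NN \<inter> {..<M}) | Some s \<Rightarrow> {s} \<inter> A i)"
          using gap_boxD(2)[OF x' i] x'A[OF i] A(1)[OF i] by (cases "p i") auto
      qed
      have "x' i \<inter> {..<N x} = x i \<inter> {..<N x}" if i: "i \<in> I" for i
      proof (cases "p i")
        case None
        then have "x' i \<inter> {M..<M'} = {}" "x i = x' i \<inter> {..<M}"
          using gap_boxD(1)[OF x' i] i by (simp_all add: x_def)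
        then show ?thesis using NM[OF \<open>x \<in> F\<close>] by (fastforce simp: not_less)
      next
        case (Some s)
        then show ?thesis using gap_boxD(2)[OF x' i Some] i by (simp add: x_def)
      qed
      then have "{x'} \<times> O' x \<subseteq> U k"
        using NO \<open>x \<in> F\<close> x' by (simp add: gap_box_def)
      then show "(x', q) \<in> U k" using q \<open>x \<in> F\<close> by (auto simp: Q_def)
    qed
    ultimately show ?case unfolding tube_def by blast
  qed
qed

subsection \<open>Improving a selection\<close>

text \<open>The exceptional pairs lie in a finite square.\<close>

lemma eventually_cofinite_pairI:
  fixes P :: "nat \<Rightarrow> nat \<Rightarrow> bool"
  assumes "\<And>n l. N \<le> n \<or> N \<le> l \<Longrightarrow> P n l"
  shows "\<forall>\<^sub>F (n, l) in cofinite. P n l"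
proof -
  have "{c. \<not> (case c of (n, l) \<Rightarrow> P n l)} \<subseteq> {..<N} \<times> {..<N}"
    using assms by (auto simp: not_le[symmetric])
  then show ?thesis unfolding eventually_cofinite by (rule finite_subset) simp
qed

lemma eventually_cofinite_bound:
  fixes h :: "'c \<Rightarrow> nat"
  assumes "\<forall>\<^sub>F c in cofinite. P c"
  obtains N where "\<And>c. N \<le> h c \<Longrightarrow> P c"
proof -
  have "finite (h ` {c. \<not> P c})" using assms by (simp add: eventually_cofinite)
  then obtain N where "\<And>c. \<not> P c \<Longrightarrow> h c < N"
    unfolding finite_nat_set_iff_bounded by auto
  then show thesis by (intro that[of N]) (meson not_le)
qed

text \<open>Exceptional pairs are bounded in both entries, so \<open>P n (r n l)\<close> can fail
  only for small \<open>n\<close> and, because of \<open>l \<le> r n l\<close>, small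
  \<open>l\<close>. This lets a correct selection survive re-indexing.\<close>

lemma eventually_cofinite_pair_shift:
  fixes P :: "nat \<Rightarrow> nat \<Rightarrow> bool"
  assumes ev: "\<forall>\<^sub>F (n, l) in cofinite. P n l" and r: "\<And>n l. l \<le> r n l"
  shows "\<forall>\<^sub>F (n, l) in cofinite. P n (r n l)"
proof -
  obtain N where N: "\<And>c. N \<le> fst c \<Longrightarrow> case c of (n, l) \<Rightarrow> P n l"
    using eventually_cofinite_bound[OF ev] by blast
  obtain N' where N': "\<And>c. N' \<le> snd c \<Longrightarrow> case c of (n, l) \<Rightarrow> P n l"
    using eventually_cofinite_bound[OF ev] by blast
  show ?thesis
  proof (rule eventually_cofinite_pairI[of "max N N'"])
    fix n l assume "max N N' \<le> n \<or> max N N' \<le> l"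
    then have "N \<le> n \<or> N' \<le> r n l" using r[of l n] by linarith
    then show "P n (r n l)" using N[of "(n, r n l)"] N'[of "(n, r n l)"] by auto
  qed
qed

lemma generalized_tower_Un_fin_subsets:
  assumes "generalized_tower \<kappa> X"
  shows "X \<union> fin_subsets \<subseteq> Pow NN"
proof -
  have "X \<subseteq> inf_subsets" using assms by (simp add: generalized_tower_def)
  then show ?thesis by (auto simp: inf_subsets_def fin_subsets_def)
qed

text \<open>\<open>S\<close> holds the values that may be frozen and \<open>\<phi>\<close> is the
  current selection. Its second argument is a spare index: composing it with \<open>r\<close>
  improves the selection without spoiling what was correct. The exceptional set of the towers goes
  into \<open>S'\<close>.\<close>

lemma selection_step:
  fixes I :: "'i set" and X :: "'i \<Rightarrow> nat set set"
    and U :: "nat \<Rightarrow> nat \<Rightarrow> (('i \<Rightarrow> nat set) \<times> 'b) set" and Y :: "'b topology"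
  defines "A \<equiv> \<lambda>i. X i \<union> fin_subsets"
  assumes I: "finite I" and X: "\<And>i. i \<in> I \<Longrightarrow> generalized_tower bounding_number (X i)"
    and Y: "S1 Borel_gamma_covers Borel_gamma_covers Y"
    and U: "\<And>n k. openin (prod_topology
        (product_topology (\<lambda>i. subtopology cantor_space (A i)) I) Y) (U n k)"
    and ev: "\<And>n x y. x \<in> PiE I A \<Longrightarrow> y \<in> topspace Y \<Longrightarrow> \<forall>\<^sub>F k in cofinite. (x, y) \<in> U n k"
    and \<phi>: "\<And>n l. l \<le> \<phi> n l" and S: "small S"
  obtains r S' where "small S'" "S \<subseteq> S'" "\<And>n l. l \<le> r n l"
    "\<And>x y. x \<in> PiE I A \<Longrightarrow> y \<in> topspace Y \<Longrightarrow> \<forall>i\<in>I. x i \<in> S \<or> x i \<notin> S' \<Longrightarrow>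
      \<forall>\<^sub>F (n, l) in cofinite. (x, y) \<in> U n (\<phi> n (r n l))"
proof -
  have A: "A i \<subseteq> Pow NN" "fin_subsets \<subseteq> A i" if "i \<in> I" for i
    using generalized_tower_Un_fin_subsets[OF X[OF that]] by (simp_all add: A_def)
  \<comment> \<open>Each coordinate is free or frozen to a value in \<open>S\<close>; finitely many
    coordinates give a small set of patterns.\<close>
  define P where "P = PiE I (\<lambda>_. insert None (Some ` S))"
  have "small (insert None (Some ` S))"
    using small_Un[OF small_finite[of "{None}"] small_image[OF S, of Some]] by simp
  then have P: "small P" unfolding P_def using I by (intro small_PiE)
  define V where "V p n k M M' = tube Y (gap_box I A p M M') (U n k)" for p n k M M'
  have V_Borel: "Borel_in Y (V p n k M M')" for p n k M M'
    unfolding V_def by (intro Borel_in_openin openin_tube)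
  have V_sub: "V p n k M M' \<subseteq> topspace Y" for p n k M M'
    using V_Borel by (rule Borel_in_subset)
  have V_mono: "V p n k M M' \<subseteq> V p n k M M''" if "M' \<le> M''" for p n k M M' M''
    unfolding V_def using that by (intro tube_mono gap_box_antimono)
  have V_ev: "\<forall>\<^sub>F k in cofinite. \<exists>M'. y \<in> V p n k M M'" if "y \<in> topspace Y" for p n M y
    unfolding V_def
    using eventually_tube_gap_box[OF I, of A Y "U n" y p M] A U ev that by auto

  \<comment> \<open>Here \<open>c = (n, M)\<close>, and \<open>k0\<close> is a threshold beyond
    which every \<open>k\<close> admits some gap end \<open>M'\<close>. \<open>G\<close> makes this
    threshold independent of \<open>y\<close> and \<open>p\<close>, up to finitely many
    \<open>c\<close>.\<close>
  define B where "B p c k0 = (\<Inter>k\<in>{k0..}. \<Union>M'. V p (fst c) k (snd c) M')" for p c k0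
  obtain G where G: "\<And>p y. p \<in> P \<Longrightarrow> y \<in> topspace Y \<Longrightarrow>
      \<forall>\<^sub>F c in cofinite. y \<in> B p c (G c)"
  proof (rule Borel_domination[OF Y P, of B])
    show "Borel_in Y (B p c k0)" for p c k0
      unfolding B_def by (intro Borel_in_Inter Borel_in_Union V_Borel) auto
    show "mono (B p c)" for p c
      unfolding B_def by (rule monoI) (meson INF_superset_mono atLeast_subset_iff order_refl)
    show "\<exists>k0. y \<in> B p c k0" if "y \<in> topspace Y" for p c y
    proof -
      have "\<forall>\<^sub>F k in sequentially. \<exists>M'. y \<in> V p (fst c) k (snd c) M'"
        using V_ev[OF that] by (simp add: cofinite_eq_sequentially)
      then show ?thesis by (auto simp: B_def eventually_sequentially)
    qed
  qed (erule that)

  \<comment> \<open>Here \<open>c = (n, M, k)\<close>. Points that admit no gap end at all are added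
    so that the sets cover \<open>Y\<close>; the choice of \<open>k\<close> at least
    \<open>G (n, M)\<close> will exclude them.\<close>
  define C where "C p c M' = V p (fst c) (snd (snd c)) (fst (snd c)) M' \<union>
      (topspace Y - (\<Union>M''. V p (fst c) (snd (snd c)) (fst (snd c)) M''))" for p c M'
  obtain H where H: "\<And>p y. p \<in> P \<Longrightarrow> y \<in> topspace Y \<Longrightarrow>
      \<forall>\<^sub>F c in cofinite. y \<in> C p c (H c)"
  proof (rule Borel_domination[OF Y P, of C])
    show "Borel_in Y (C p c M')" for p c M'
      unfolding C_def
      by (intro Borel_in_Un Borel_in_Diff Borel_in_Union V_Borel Borel_in_openin openin_topspace)
    show "mono (C p c)" for p c
      unfolding C_def by (intro monoI Un_mono V_mono order_refl)
    show "\<exists>M'. y \<in> C p c M'" if "y \<in> topspace Y" for p c y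
      using that by (auto simp: C_def)
  qed (erule that)

  \<comment> \<open>\<open>\<psi> n M\<close> is the index used when the gap starts at
    \<open>M\<close>. It is a value of \<open>\<phi> n\<close>, and
    \<open>l \<le> \<phi> n l\<close> lifts it to at least \<open>G (n, M)\<close>.\<close>
  define \<rho> where "\<rho> n M = max (G (n, M)) M" for n M
  define \<psi> where "\<psi> n M = \<phi> n (\<rho> n M)" for n M
  have \<psi>: "G (n, M) \<le> \<psi> n M" for n M
    using \<phi>[of "\<rho> n M" n] by (simp add: \<rho>_def \<psi>_def)
  \<comment> \<open>Starting at 1 keeps the endpoints in \<open>NN\<close>. The sum makes
    \<open>a (Suc j)\<close> large enough as the end of a gap from \<open>a j\<close>, for all
    \<open>n \<le> j\<close> at once.\<close>
  define a where "a = rec_nat 1 (\<lambda>j v. Suc v + (\<Sum>n\<le>j. H (n, v, \<psi> n v)))"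
  have a_0: "0 < a 0" by (simp add: a_def)
  have a_Suc: "a (Suc j) = Suc (a j) + (\<Sum>n\<le>j. H (n, a j, \<psi> n (a j)))" for j
    by (simp add: a_def)
  have a: "strict_mono a" by (simp add: strict_mono_Suc_iff a_Suc)
  have H_a: "H (n, a j, \<psi> n (a j)) \<le> a (Suc j)" if "n \<le> j" for n j
    using member_le_sum[of n "{..j}" "\<lambda>n. H (n, a j, \<psi> n (a j))"] that by (simp add: a_Suc)

  have "\<exists>b S. infinite b \<and> small S \<and>
      (\<forall>i\<in>I. \<forall>x\<in>X i - S. finite (x \<inter> (\<Union>j\<in>b. {a j..<a (Suc j)})))"
    by (rule generalized_towers_strict_mono[OF I _ a a_0]) (rule X)
  then obtain b S0 where b: "infinite b" and S0: "small S0"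
    and fin: "\<forall>i\<in>I. \<forall>x\<in>X i - S0. finite (x \<inter> (\<Union>j\<in>b. {a j..<a (Suc j)}))"
    by (elim exE conjE)
  \<comment> \<open>\<open>n \<le> j\<close> is needed for \<open>H_a\<close>, and
    \<open>l \<le> j\<close> for \<open>l \<le> r n l\<close>.\<close>
  have "\<exists>j\<in>b. max n l \<le> j" for n l
    using b unfolding infinite_nat_iff_unbounded_le by blast
  then obtain j where j: "\<And>n l. j n l \<in> b" "\<And>n l. max n l \<le> j n l" by metis
  define r where "r n l = \<rho> n (a (j n l))" for n l

  show thesis
  proof (rule that[of "S \<union> S0" r])
    show "small (S \<union> S0)" using S S0 by (rule small_Un)
    show "S \<subseteq> S \<union> S0" by simp
    show "l \<le> r n l" for n l
      using j(2)[of n l] strict_mono_imp_increasing[OF a, of "j n l"] by (auto simp: r_def \<rho>_def)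
    fix x y
    assume x: "x \<in> PiE I A" and y: "y \<in> topspace Y" and dich: "\<forall>i\<in>I. x i \<in> S \<or> x i \<notin> S \<union> S0"
    \<comment> \<open>Freezes exactly the coordinates in \<open>S\<close>. The others avoid
      \<open>S0\<close>, so either the tower property or their finiteness makes them miss almost all
      intervals indexed by \<open>b\<close>.\<close>
    define p where "p = (\<lambda>i\<in>I. if x i \<in> S then Some (x i) else None)"
    have p: "p \<in> P" by (auto simp: p_def P_def)
    have "\<exists>N. \<forall>j\<in>b. N \<le> j \<longrightarrow> x i \<inter> {a j..<a (Suc j)} = {}" if i: "i \<in> I" "x i \<notin> S" for i
    proof -
      have "finite (x i \<inter> (\<Union>j\<in>b. {a j..<a (Suc j)}))"
      proof (cases "x i \<in> X i")
        case True
        then show ?thesis using fin dich i by blast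
      next
        case False
        then show ?thesis using x i by (auto simp: A_def fin_subsets_def dest!: PiE_mem)
      qed
      then obtain N where N: "\<And>z. z \<in> x i \<inter> (\<Union>j\<in>b. {a j..<a (Suc j)}) \<Longrightarrow> z < N"
        unfolding finite_nat_set_iff_bounded by blast
      have "x i \<inter> {a j..<a (Suc j)} = {}" if "j \<in> b" "N \<le> j" for j
      proof -
        have "N \<le> a j" using strict_mono_imp_increasing[OF a, of j] that by linarith
        then show ?thesis using N that(1) by fastforce
      qed
      then show ?thesis by blast
    qed
    then obtain N0 where N0: "\<And>i j. i \<in> I \<Longrightarrow> x i \<notin> S \<Longrightarrow> j \<in> b \<Longrightarrow> N0 i \<le> j \<Longrightarrow>
        x i \<inter> {a j..<a (Suc j)} = {}"
      by metis
    \<comment> \<open>Exceptions for \<open>G\<close> and \<open>H\<close> are bounded in the entry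
      \<open>M\<close>. Below, \<open>M\<close> is \<open>a (j n l) \<ge> j n l\<close>, which is
      large as soon as \<open>n\<close> or \<open>l\<close> is.\<close>
    obtain N1 where N1: "\<And>c. N1 \<le> snd c \<Longrightarrow> y \<in> B p c (G c)"
      using eventually_cofinite_bound[OF G[OF p y], of snd] by metis
    obtain N2 where N2: "\<And>c. N2 \<le> fst (snd c) \<Longrightarrow> y \<in> C p c (H c)"
      using eventually_cofinite_bound[OF H[OF p y], of "\<lambda>c. fst (snd c)"] by metis
    define N where "N = N1 + N2 + sum N0 I"
    have N: "N1 \<le> N" "N2 \<le> N" "\<And>i. i \<in> I \<Longrightarrow> N0 i \<le> N"
      using I by (simp_all add: N_def member_le_sum trans_le_add2)
    show "\<forall>\<^sub>F (n, l) in cofinite. (x, y) \<in> U n (\<phi> n (r n l))"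
    proof (rule eventually_cofinite_pairI[of N])
      fix n l assume "N \<le> n \<or> N \<le> l"
      then have j_ge: "N \<le> j n l" using j(2)[of n l] by linarith
      define M k where "M = a (j n l)" and "k = \<psi> n M"
      have M: "N \<le> M"
        using j_ge strict_mono_imp_increasing[OF a, of "j n l"] by (simp add: M_def)
      have "y \<in> B p (n, M) (G (n, M))" using N1[of "(n, M)"] N(1) M by simp
      then have "\<exists>M'. y \<in> V p n k M M'" using \<psi>[of n M] by (auto simp: B_def k_def)
      moreover have "y \<in> C p (n, M, k) (H (n, M, k))" using N2[of "(n, M, k)"] N(2) M by simp
      ultimately have "y \<in> V p n k M (H (n, M, k))" by (auto simp: C_def)
      moreover have "H (n, M, k) \<le> a (Suc (j n l))"
        unfolding M_def k_def using j(2)[of n l] by (intro H_a) simp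
      ultimately have "y \<in> tube Y (gap_box I A p M (a (Suc (j n l)))) (U n k)"
        using V_mono unfolding V_def by blast
      moreover have "x \<in> gap_box I A p M (a (Suc (j n l)))"
      proof -
        have "case p i of None \<Rightarrow> x i \<inter> {M..<a (Suc (j n l))} = {} | Some s \<Rightarrow> x i = s"
          if i: "i \<in> I" for i
        proof (cases "x i \<in> S")
          case True
          then show ?thesis using i by (simp add: p_def)
        next
          case False
          then have "x i \<inter> {M..<a (Suc (j n l))} = {}"
            unfolding M_def using N0[OF i False j(1)] le_trans[OF N(3)[OF i] j_ge] by blast
          then show ?thesis using i False by (simp add: p_def)
        qed
        then show ?thesis using x by (simp add: gap_box_def)
      qed
      ultimately have "(x, y) \<in> U n k" by (rule tubeD)
      then show "(x, y) \<in> U n (\<phi> n (r n l))" by (simp add: k_def \<psi>_def r_def M_def)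
    qed
  qed
qed

section \<open>Iteration along a chain of small sets\<close>

lemma chain_level:
  fixes S :: "nat \<Rightarrow> 'c set"
  assumes I: "finite I" and S: "\<And>t. S t \<subseteq> S (Suc t)"
  shows "\<exists>t\<le>card I. \<forall>i\<in>I. x i \<in> S t \<or> x i \<notin> S (Suc t)"
proof (rule ccontr)
  assume "\<not> ?thesis"
  \<comment> \<open>Otherwise some coordinate value enters the chain at each of
    \<open>card I + 1\<close> levels. As the chain increases, a value enters only once, so distinct
    levels need distinct indices, one more than \<open>I\<close> has.\<close>
  then have "\<exists>i. i \<in> I \<and> x i \<notin> S t \<and> x i \<in> S (Suc t)" if "t \<le> card I" for t
    using that by blast
  then obtain h where h: "\<And>t. t \<le> card I \<Longrightarrow> h t \<in> I \<and> x (h t) \<notin> S t \<and> x (h t) \<in> S (Suc t)"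
    by metis
  have mono: "S s \<subseteq> S t" if "s \<le> t" for s t
    using S that by (rule lift_Suc_mono_le)
  have "h s \<noteq> h t" if "s < t" "t \<le> card I" for s t
    using h[of s] h[of t] mono[of "Suc s" t] that by auto
  then have "inj_on h {..card I}"
    by (intro linorder_inj_onI) auto
  moreover have "h ` {..card I} \<subseteq> I" using h by auto
  ultimately have "card {..card I} \<le> card I" using I by (rule card_inj_on_le)
  then show False by simp
qed

theorem theorem3p1:
  fixes m :: nat and X :: "nat \<Rightarrow> nat set set" and Y :: "'a topology"
  assumes "m \<ge> 1"
    and "\<forall>i\<in>{1..m}. generalized_tower bounding_number (X i)"
    and "set_of_reals Y"
    and "S1 Borel_gamma_covers Borel_gamma_covers Y"
  shows "S1 open_gamma_covers open_gamma_covers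
    (prod_topology
      (product_topology (\<lambda>i. subtopology cantor_space (X i \<union> fin_subsets)) {1..m})
      Y)"
proof (rule S1_open_gamma_coversI)
  let ?A = "\<lambda>i. X i \<union> fin_subsets"
  let ?I = "{1..m}"
  let ?T = "prod_topology (product_topology (\<lambda>i. subtopology cantor_space (?A i)) ?I) Y"
  fix U :: "nat \<Rightarrow> nat \<Rightarrow> ((nat \<Rightarrow> nat set) \<times> 'a) set"
  assume U: "\<And>n k. openin ?T (U n k)"
    and ev: "\<And>n x. x \<in> topspace ?T \<Longrightarrow> \<forall>\<^sub>F k in cofinite. x \<in> U n k"
  have "?A i \<subseteq> Pow NN" if "i \<in> ?I" for i
    using generalized_tower_Un_fin_subsets assms(2) that by blast
  then have "topspace (product_topology (\<lambda>i. subtopology cantor_space (?A i)) ?I) = PiE ?I ?A"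
    unfolding topspace_product_topology
    by (intro PiE_cong) (simp add: topspace_cantor_space Int_absorb1 del: Un_subset_iff)
  then have top: "topspace ?T = PiE ?I ?A \<times> topspace Y" by simp
  \<comment> \<open>Quantifying over pairs instead of \<open>n\<close> alone leaves room for
    re-indexing \<open>l\<close> in later steps.\<close>
  define good where "good \<phi> x \<longleftrightarrow> (\<forall>\<^sub>F (n, l) in cofinite. x \<in> U n (\<phi> n l))"
    for \<phi> :: "nat \<Rightarrow> nat \<Rightarrow> nat" and x
  \<comment> \<open>A state \<open>\<sigma>\<close> pairs a selection with the set of values to be
    frozen next. \<open>P\<close> is what \<open>selection_step\<close> requires of a state,
    \<open>Q\<close> what one step achieves.\<close>
  define P where "P \<sigma> \<longleftrightarrow> (\<forall>n l. l \<le> fst \<sigma> n l) \<and> small (snd \<sigma>)"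
    for \<sigma> :: "(nat \<Rightarrow> nat \<Rightarrow> nat) \<times> nat set set"
  define Q where "Q \<sigma> \<tau> \<longleftrightarrow> snd \<sigma> \<subseteq> snd \<tau> \<and> (\<forall>x. good (fst \<sigma>) x \<longrightarrow> good (fst \<tau>) x) \<and>
      (\<forall>x y. (x, y) \<in> topspace ?T \<longrightarrow> (\<forall>i\<in>?I. x i \<in> snd \<sigma> \<or> x i \<notin> snd \<tau>) \<longrightarrow> good (fst \<tau>) (x, y))"
    for \<sigma> \<tau> :: "(nat \<Rightarrow> nat \<Rightarrow> nat) \<times> nat set set"
  have "\<exists>\<sigma>. \<forall>t. P (\<sigma> t) \<and> Q (\<sigma> t) (\<sigma> (Suc t))"
  proof (rule dependent_nat_choice)
    show "\<exists>\<sigma>. P \<sigma>"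
      by (rule exI[of _ "(\<lambda>n l. l, {})"]) (simp add: P_def small_finite)
    fix \<sigma> assume "P \<sigma>"
    then have \<phi>: "\<And>n l. l \<le> fst \<sigma> n l" and S: "small (snd \<sigma>)" by (simp_all add: P_def)
    obtain r S' where S': "small S'" "snd \<sigma> \<subseteq> S'" and r: "\<And>n l. l \<le> r n l"
      and sel: "\<And>x y. x \<in> PiE ?I ?A \<Longrightarrow> y \<in> topspace Y \<Longrightarrow> \<forall>i\<in>?I. x i \<in> snd \<sigma> \<or> x i \<notin> S' \<Longrightarrow>
        \<forall>\<^sub>F (n, l) in cofinite. (x, y) \<in> U n (fst \<sigma> n (r n l))"
      by (rule selection_step[of ?I X Y U "fst \<sigma>" "snd \<sigma>"])
        (use assms(2,4) U ev top \<phi> S in auto)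
    let ?\<tau> = "(\<lambda>n l. fst \<sigma> n (r n l), S')"
    have "P ?\<tau>" using S'(1) le_trans[OF r \<phi>] by (simp add: P_def)
    moreover have "Q \<sigma> ?\<tau>"
      using S'(2) sel eventually_cofinite_pair_shift[OF _ r]
      unfolding Q_def good_def top by auto
    ultimately show "\<exists>\<tau>. P \<tau> \<and> Q \<sigma> \<tau>" by blast
  qed
  then obtain \<sigma> where \<sigma>: "\<And>t. Q (\<sigma> t) (\<sigma> (Suc t))" by blast
  \<comment> \<open>By \<open>chain_level\<close>, every point becomes good in one of the first
    \<open>card ?I + 1\<close> steps, and goodness persists up to this stage.\<close>
  define \<phi> where "\<phi> = fst (\<sigma> (Suc (card ?I)))"
  have "\<forall>\<^sub>F n in cofinite. z \<in> U n (\<phi> n n)" if z: "z \<in> topspace ?T" for z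
  proof -
    obtain x y where xy: "z = (x, y)" by fastforce
    obtain t where t: "t \<le> card ?I" "\<forall>i\<in>?I. x i \<in> snd (\<sigma> t) \<or> x i \<notin> snd (\<sigma> (Suc t))"
      using chain_level[of ?I "\<lambda>t. snd (\<sigma> t)" x] \<sigma> unfolding Q_def by blast
    have step: "good (fst (\<sigma> s)) z \<Longrightarrow> good (fst (\<sigma> (Suc s))) z" for s
      using \<sigma>[of s] unfolding Q_def by blast
    have "good (fst (\<sigma> (Suc t))) z"
      using \<sigma>[of t] t(2) z unfolding Q_def xy by blast
    have "Suc t \<le> Suc (card ?I)" using t(1) by simp
    then have "good \<phi> z"
      unfolding \<phi>_def by (induction rule: dec_induct) (fact | erule step)+
    \<comment> \<open>For \<open>n \<ge> N\<close> every \<open>l\<close> is correct; the diagonal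
      \<open>l = n\<close> is one possible choice.\<close>
    then obtain N where "\<And>c. N \<le> fst c \<Longrightarrow> case c of (n, l) \<Rightarrow> z \<in> U n (\<phi> n l)"
      unfolding good_def using eventually_cofinite_bound by blast
    then have "\<forall>n\<ge>N. z \<in> U n (\<phi> n n)" by fastforce
    then show ?thesis unfolding cofinite_eq_sequentially eventually_sequentially by blast
  qed
  then show "\<exists>f. \<forall>x\<in>topspace ?T. \<forall>\<^sub>F n in cofinite. x \<in> U n (f n)"
    by (intro exI[of _ "\<lambda>n. \<phi> n n"] ballI)
qed

end
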